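(* Let $G=(V,E)$ be a finite directed graph with a kernel $K$ and nowhere-zero stationary distribution $\pi$. For every $1\le n\le|V|$, $$\overline{\lambda}_n\le \iota_n(G,K),$$ where $\overline\lambda_n=\frac1n\sum_{i=1}^n\lambda_i$, $\lambda_1\le\lambda_2\le\dots\le\lambda_{|V|}$ are the eigenvalues (with multiplicity) of the symmetric Laplacian $\Delta$, and $\iota_n(G,K)=\min\frac1n\sum_{i=1}^n\vec\partial(Q_i)/\pi(Q_i)$ over all families of $n$ nonempty pairwise disjoint subsets $Q_1,\dots,Q_n$ of $V$.
   Context: $G=(V,E)$ is a finite directed graph (loops allowed). A kernel on $G$ is a row-stochastic matrix $K:V\times V\to[0,1]$ with $K(u,v)>0$ for every edge $uv\in E$ and $K(u,v)=0$ whenever $u\neq v$, $uv\notin E$. $\pi:V\to(0,\infty)$ is a probability vector with $\pi K=\pi$. Put $\phi(u,v)=K(u,v)\pi(u)$; for $Q\subseteq V$, $\pi(Q)=\sum_{u\in Q}\pi(u)$ and $\vec\partial(Q)=\sum_{u\in Q,v\notin Q}\phi(u,v)$. Let $\overline K(u,v)=\frac12\big(K(u,v)+K(v,u)\pi(v)/\pi(u)\big)$ and $\Delta=\mathrm{id}-\overline K$, acting on functions $V\to\mathbb R$; $\Delta$ is self-adjoint with respect to $\langle f,g\rangle_\pi=\sum_u f(u)g(u)\pi(u)$, so its eigenvalues are real. *)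

theory Defs
  imports "HOL-Analysis.Analysis" "HOL-Library.Multiset" "HOL-Library.Disjoint_Sets"
begin

text \<open>
  The vertex set of the finite directed graph is a finite type \<open>'v\<close>; the graph is given by its
  edge relation \<open>E\<close>, which may contain loops. A kernel may be lazy: \<open>K u u\<close> may be positive even if
  \<open>(u, u)\<close> is not an edge.
\<close>

definition graph_kernel :: "('v::finite \<times> 'v) set \<Rightarrow> ('v \<Rightarrow> 'v \<Rightarrow> real) \<Rightarrow> bool" where
  "graph_kernel E K \<longleftrightarrow>
     (\<forall>u v. 0 \<le> K u v \<and> K u v \<le> 1) \<and>
     (\<forall>u. (\<Sum>v\<in>UNIV. K u v) = 1) \<and>
     (\<forall>u v. (u, v) \<in> E \<longrightarrow> K u v > 0) \<and>
     (\<forall>u v. u \<noteq> v \<and> (u, v) \<notin> E \<longrightarrow> K u v = 0)"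

definition stationary_distribution :: "('v::finite \<Rightarrow> 'v \<Rightarrow> real) \<Rightarrow> ('v \<Rightarrow> real) \<Rightarrow> bool" where
  "stationary_distribution K \<pi> \<longleftrightarrow>
     (\<forall>u. 0 \<le> \<pi> u) \<and> (\<Sum>u\<in>UNIV. \<pi> u) = 1 \<and>
     (\<forall>v. (\<Sum>u\<in>UNIV. \<pi> u * K u v) = \<pi> v)"

definition flow :: "('v \<Rightarrow> 'v \<Rightarrow> real) \<Rightarrow> ('v \<Rightarrow> real) \<Rightarrow> 'v \<Rightarrow> 'v \<Rightarrow> real" where
  "flow K \<pi> u v = K u v * \<pi> u"

definition out_boundary :: "('v::finite \<Rightarrow> 'v \<Rightarrow> real) \<Rightarrow> ('v \<Rightarrow> real) \<Rightarrow> 'v set \<Rightarrow> real" where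
  "out_boundary K \<pi> Q = (\<Sum>u\<in>Q. \<Sum>v\<in>-Q. flow K \<pi> u v)"

definition sym_kernel :: "('v \<Rightarrow> 'v \<Rightarrow> real) \<Rightarrow> ('v \<Rightarrow> real) \<Rightarrow> 'v \<Rightarrow> 'v \<Rightarrow> real" where
  "sym_kernel K \<pi> u v = (K u v + K v u * \<pi> v / \<pi> u) / 2"

definition laplacian ::
  "('v::finite \<Rightarrow> 'v \<Rightarrow> real) \<Rightarrow> ('v \<Rightarrow> real) \<Rightarrow> real ^ 'v \<Rightarrow> real ^ 'v" where
  "laplacian K \<pi> f = f - (\<chi> u. \<Sum>v\<in>UNIV. sym_kernel K \<pi> u v * f $ v)"

definition eigenspace :: "('a::real_vector \<Rightarrow> 'a) \<Rightarrow> real \<Rightarrow> 'a set" where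
  "eigenspace T \<mu> = {f. T f = \<mu> *\<^sub>R f}"

definition eigenvalues :: "('a::real_vector \<Rightarrow> 'a) \<Rightarrow> real set" where
  "eigenvalues T = {\<mu>. \<exists>f. f \<noteq> 0 \<and> T f = \<mu> *\<^sub>R f}"

text \<open>
  Each eigenvalue is repeated according to the dimension of its eigenspace. For a self-adjoint
  operator, such as the Laplacian with respect to the inner product weighted by \<open>\<pi>\<close>, this is also
  its algebraic multiplicity, and the list has as many entries as the dimension of the space.
\<close>

definition eigenvalue_list :: "('a::real_vector \<Rightarrow> 'a) \<Rightarrow> real list" where
  "eigenvalue_list T =
     sorted_list_of_multiset (\<Sum>\<mu>\<in>eigenvalues T. replicate_mset (dim (eigenspace T \<mu>)) \<mu>)"

text \<open>The indices of the eigenvalues start at 1.\<close>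

definition lap_eigenvalue :: "('v::finite \<Rightarrow> 'v \<Rightarrow> real) \<Rightarrow> ('v \<Rightarrow> real) \<Rightarrow> nat \<Rightarrow> real" where
  "lap_eigenvalue K \<pi> i = eigenvalue_list (laplacian K \<pi>) ! (i - 1)"

definition mean_lap_eigenvalue :: "('v::finite \<Rightarrow> 'v \<Rightarrow> real) \<Rightarrow> ('v \<Rightarrow> real) \<Rightarrow> nat \<Rightarrow> real" where
  "mean_lap_eigenvalue K \<pi> n = (1 / real n) * (\<Sum>i=1..n. lap_eigenvalue K \<pi> i)"

definition disjoint_nonempty_families :: "nat \<Rightarrow> (nat \<Rightarrow> 'v set) set" where
  "disjoint_nonempty_families n =
     {Q. (\<forall>i\<in>{1..n}. Q i \<noteq> {}) \<and> disjoint_family_on Q {1..n}}"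

definition mean_expansion ::
  "('v::finite \<Rightarrow> 'v \<Rightarrow> real) \<Rightarrow> ('v \<Rightarrow> real) \<Rightarrow> nat \<Rightarrow> (nat \<Rightarrow> 'v set) \<Rightarrow> real" where
  "mean_expansion K \<pi> n Q = (1 / real n) * (\<Sum>i=1..n. out_boundary K \<pi> (Q i) / sum \<pi> (Q i))"

definition iso_constant :: "('v::finite \<Rightarrow> 'v \<Rightarrow> real) \<Rightarrow> ('v \<Rightarrow> real) \<Rightarrow> nat \<Rightarrow> real" where
  "iso_constant K \<pi> n = Min (mean_expansion K \<pi> n ` disjoint_nonempty_families n)"

text \<open>The minimum is taken over a finite set, which is nonempty when \<open>n \<le> CARD('v)\<close>.\<close>

lemma finite_mean_expansions:
  fixes K :: "'v::finite \<Rightarrow> 'v \<Rightarrow> real"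
  shows "finite (mean_expansion K \<pi> n ` disjoint_nonempty_families n)"
proof (rule finite_subset)
  show "mean_expansion K \<pi> n ` disjoint_nonempty_families n
      \<subseteq> mean_expansion K \<pi> n ` ({1..n} \<rightarrow>\<^sub>E UNIV)"
  proof (rule image_subsetI)
    fix Q :: "nat \<Rightarrow> 'v set"
    show "mean_expansion K \<pi> n Q \<in> mean_expansion K \<pi> n ` ({1..n} \<rightarrow>\<^sub>E UNIV)"
    proof (rule image_eqI[where x = "restrict Q {1..n}"])
      show "mean_expansion K \<pi> n Q = mean_expansion K \<pi> n (restrict Q {1..n})"
        by (simp add: mean_expansion_def)
      show "restrict Q {1..n} \<in> {1..n} \<rightarrow>\<^sub>E UNIV"
        by (simp add: restrict_PiE_iff)
    qed
  qed
  show "finite (mean_expansion K \<pi> n ` ({1..n} \<rightarrow>\<^sub>E (UNIV :: 'v set set)))"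
    by (intro finite_imageI finite_PiE) simp_all
qed

lemma disjoint_nonempty_families_nonempty:
  assumes "n \<le> CARD('v::finite)"
  shows "(disjoint_nonempty_families n :: (nat \<Rightarrow> 'v set) set) \<noteq> {}"
proof -
  have "card {1..n} \<le> card (UNIV :: 'v set)"
    using assms by simp
  then have "\<exists>f. f ` {1..n} \<subseteq> (UNIV :: 'v set) \<and> inj_on f {1..n}"
    by (intro card_le_inj) simp_all
  then obtain f :: "nat \<Rightarrow> 'v" where f: "inj_on f {1..n}"
    by (elim exE conjE)
  have "(\<lambda>i. {f i}) \<in> disjoint_nonempty_families n"
    using f unfolding disjoint_nonempty_families_def disjoint_family_on_def
    by (simp add: inj_on_eq_iff)
  then show ?thesis by blast
qed

end

theory Submission imports Defs begin

text \<open>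
  The bound is Ky Fan's variational principle: the sum of the \<open>n\<close> smallest eigenvalues of a
  self-adjoint operator is at most the trace of its quadratic form on any \<open>n\<close> orthonormal vectors.
  The normalised indicators of disjoint sets \<open>Q\<^sub>1, \<dots>, Q\<^sub>n\<close> are orthonormal for the inner product
  weighted by \<open>\<pi>\<close>, and the quadratic form of the Laplacian takes on them exactly the values
  \<open>\<partial>(Q\<^sub>i) / \<pi>(Q\<^sub>i)\<close>. Conjugation with multiplication by \<open>\<surd>\<pi>\<close> turns the weighted inner
  product into the standard one without changing the spectrum.
\<close>

section \<open>Spectral theorem for self-adjoint operators on a Euclidean space\<close>

text \<open>A minimiser of the Rayleigh quotient on the compact unit sphere of \<open>S\<close> is
  an eigenvector: by invariance its residual \<open>T x - m x\<close> lies in \<open>S\<close>, and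
  moving \<open>x\<close> along a nonzero residual would push the quotient below its
  minimum.\<close>

lemma selfadjoint_eigenvector_in_subspace:
  fixes T :: "'a::euclidean_space \<Rightarrow> 'a"
  assumes lin: "linear T" and sa: "\<And>x y. T x \<bullet> y = x \<bullet> T y"
    and S: "subspace S" and inv: "T ` S \<subseteq> S" and ne: "S \<noteq> {0}"
  obtains x m where "x \<in> S" "norm x = 1" "T x = m *\<^sub>R x"
proof -
  have "0 \<in> S"
    using S by (rule subspace_0)
  with ne obtain y where y: "y \<in> S" "y \<noteq> 0"
    by blast
  then have "y /\<^sub>R norm y \<in> sphere 0 1 \<inter> S"
    using S by (simp add: subspace_scale)
  then have "sphere 0 1 \<inter> S \<noteq> {}"
    by blast
  moreover have "compact (sphere 0 1 \<inter> S)"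
    using S by (simp add: closed_subspace compact_Int_closed)
  moreover have "continuous_on (sphere 0 1 \<inter> S) (\<lambda>x. T x \<bullet> x)"
    using lin by (intro continuous_intros linear_continuous_on linear_conv_bounded_linear[THEN iffD1])
  ultimately obtain x where x: "x \<in> sphere 0 1 \<inter> S"
    and min: "\<And>y. y \<in> sphere 0 1 \<inter> S \<Longrightarrow> T x \<bullet> x \<le> T y \<bullet> y"
    using continuous_attains_inf[of "sphere 0 1 \<inter> S" "\<lambda>x. T x \<bullet> x"] by blast
  define m where "m = T x \<bullet> x"
  \<comment> \<open>The quadratic form of \<open>T - m\<close>: it vanishes at \<open>x\<close> and,
    by minimality and homogeneity, is nonnegative on all of \<open>S\<close>.\<close>
  define r where "r y = T y \<bullet> y - m * (y \<bullet> y)" for y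
  define z where "z = T x - m *\<^sub>R x"
  have xx: "x \<bullet> x = 1" "x \<in> S" "norm x = 1"
    using x by (simp_all add: norm_eq_1)
  have zS: "z \<in> S"
    using xx inv S unfolding z_def by (auto intro!: subspace_diff subspace_scale)
  have r_nonneg: "0 \<le> r y" if "y \<in> S" for y
  proof (cases "y = 0")
    case True
    then show ?thesis using lin by (simp add: r_def linear_0)
  next
    case False
    have "y /\<^sub>R norm y \<in> sphere 0 1 \<inter> S"
      using False that S by (simp add: subspace_scale)
    then have "m \<le> T (y /\<^sub>R norm y) \<bullet> (y /\<^sub>R norm y)"
      unfolding m_def by (rule min)
    also have "\<dots> = (T y \<bullet> y) / (y \<bullet> y)"
      using lin by (simp add: linear_scale dot_square_norm power2_eq_square divide_simps)
    finally show ?thesis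
      using False by (simp add: r_def field_simps)
  qed
  have r_line: "r (x + t *\<^sub>R z) = 2 * t * (z \<bullet> z) + t\<^sup>2 * r z" for t
  proof -
    have "T x = z + m *\<^sub>R x"
      by (simp add: z_def)
    moreover have "T z \<bullet> x = z \<bullet> T x"
      by (rule sa)
    moreover have "x \<bullet> z = 0"
      by (simp add: z_def inner_diff_right xx m_def inner_commute)
    ultimately show ?thesis
      using xx lin
      by (simp add: r_def linear_add linear_scale inner_add_left inner_add_right power2_eq_square
          inner_commute algebra_simps)
  qed
  have "z \<bullet> z = 0"
  proof (rule ccontr)
    assume nz: "z \<bullet> z \<noteq> 0"
    \<comment> \<open>The summand 1 keeps \<open>c\<close> positive even if \<open>r z = 0\<close>.
      The chosen \<open>t\<close> minimises \<open>2 * t * (z \<bullet> z) + t^2 * c\<close>, with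
      value \<open>- (z \<bullet> z)^2 / c\<close>.\<close>
    define c where "c = r z + 1"
    define t where "t = - (z \<bullet> z) / c"
    have c: "c > 0"
      using r_nonneg[OF zS] by (simp add: c_def)
    have "0 \<le> r (x + t *\<^sub>R z)"
      using xx zS S by (intro r_nonneg subspace_add subspace_scale)
    also have "\<dots> = 2 * t * (z \<bullet> z) + t\<^sup>2 * (c - 1)"
      by (simp add: r_line c_def)
    also have "\<dots> = - (z \<bullet> z)\<^sup>2 / c - t\<^sup>2"
      using c by (simp add: t_def power2_eq_square divide_simps algebra_simps)
    also have "\<dots> < 0"
    proof -
      have "(z \<bullet> z)\<^sup>2 / c > 0"
        using nz c by simp
      moreover have "t\<^sup>2 \<ge> 0"
        by simp
      ultimately show ?thesis
        by linarith
    qed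
    finally show False by simp
  qed
  then have "T x = m *\<^sub>R x"
    by (simp add: z_def)
  with xx that show thesis
    by blast
qed

text \<open>Induction on the dimension: split off one unit eigenvector \<open>x\<close>. Its
  orthogonal complement within \<open>S\<close> has smaller dimension and is again invariant,
  because \<open>x \<bullet> T y = T x \<bullet> y\<close> is a multiple of
  \<open>x \<bullet> y\<close>.\<close>

lemma selfadjoint_orthonormal_eigenbasis_subspace:
  fixes T :: "'a::euclidean_space \<Rightarrow> 'a"
  assumes lin: "linear T" and sa: "\<And>x y. T x \<bullet> y = x \<bullet> T y"
    and "subspace S" and "T ` S \<subseteq> S"
  shows "\<exists>B\<subseteq>S. pairwise orthogonal B \<and> (\<forall>b\<in>B. norm b = 1) \<and> span B = S \<and>
           (\<forall>b\<in>B. \<exists>m. T b = m *\<^sub>R b)"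
  using assms(3,4)
proof (induction "dim S" arbitrary: S rule: less_induct)
  case less
  show ?case
  proof (cases "S = {0}")
    case True
    then show ?thesis by (intro exI[of _ "{}"]) simp
  next
    case False
    then obtain x m where x: "x \<in> S" "norm x = 1" "T x = m *\<^sub>R x"
      using selfadjoint_eigenvector_in_subspace[OF lin sa less.prems] by blast
    have xx: "x \<bullet> x = 1"
      using x by (simp add: norm_eq_1)
    define S' where "S' = S \<inter> {y. x \<bullet> y = 0}"
    have sub: "subspace S'"
      unfolding S'_def using less.prems(1) subspace_hyperplane by (rule subspace_inter)
    have "x \<bullet> T y = 0" if "x \<bullet> y = 0" for y
      using sa[of x y] x that by simp
    then have inv: "T ` S' \<subseteq> S'"
      using less.prems(2) by (auto simp: S'_def)
    have "x \<notin> S'"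
      using xx by (simp add: S'_def)
    then have "S' \<subset> S"
      using x(1) unfolding S'_def by blast
    then have "dim S' < dim S"
      using sub less.prems(1) by (intro dim_psubset) (simp add: span_eq_iff[THEN iffD2])
    from less.hyps[OF this sub inv] obtain B where B: "B \<subseteq> S'" "pairwise orthogonal B"
      "\<forall>b\<in>B. norm b = 1" "span B = S'" "\<forall>b\<in>B. \<exists>m. T b = m *\<^sub>R b"
      by blast
    have "S \<subseteq> span (insert x B)"
    proof
      fix y assume "y \<in> S"
      then have "y - (x \<bullet> y) *\<^sub>R x \<in> S'"
        using x xx less.prems(1) by (simp add: S'_def subspace_diff subspace_scale inner_diff_right)
      then show "y \<in> span (insert x B)"
        unfolding span_breakdown_eq B(4) by blast
    qed
    moreover have "span (insert x B) \<subseteq> S"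
      using B(1) x less.prems(1) by (intro span_minimal) (auto simp: S'_def)
    moreover have "pairwise orthogonal (insert x B)"
      using B by (auto simp: pairwise_insert S'_def orthogonal_def inner_commute)
    ultimately show ?thesis
      using B x by (intro exI[of _ "insert x B"]) (auto simp: S'_def)
  qed
qed

section \<open>Reading the eigenvalue list off an orthonormal eigenbasis\<close>

text \<open>Attaching eigenvalues to basis vectors retains multiplicities: a repeated eigenvalue is
  a fibre of \<mu> with several elements.\<close>

locale orthonormal_eigenbasis =
  fixes T :: "'a::euclidean_space \<Rightarrow> 'a" and B :: "'a set" and \<mu> :: "'a \<Rightarrow> real"
  assumes linear: "linear T"
    and orthogonal: "pairwise orthogonal B"
    and norm_1: "b \<in> B \<Longrightarrow> norm b = 1"
    and span_UNIV: "span B = UNIV"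
    and eigen: "b \<in> B \<Longrightarrow> T b = \<mu> b *\<^sub>R b"
begin

lemma independent_basis: "independent B"
  \<comment> \<open>The instance at 0 excludes the zero vector from \<open>B\<close>.\<close>
  using orthogonal norm_1[of 0] by (intro pairwise_orthogonal_independent) auto

lemma finite_basis: "finite B"
  using independent_basis by (rule independent_imp_finite)

lemma inner_basis: "b \<in> B \<Longrightarrow> c \<in> B \<Longrightarrow> b \<bullet> c = (if b = c then 1 else 0)"
  using orthogonal norm_1 by (auto simp: pairwise_def orthogonal_def norm_eq_1)

lemma expand: "(\<Sum>b\<in>B. (x \<bullet> b) *\<^sub>R b) = x"
  using orthogonal norm_1 finite_basis by (intro orthonormal_basis_expand) (simp_all add: span_UNIV)

lemma expand_image: "T x = (\<Sum>b\<in>B. (\<mu> b * (x \<bullet> b)) *\<^sub>R b)"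
proof -
  have "T x = T (\<Sum>b\<in>B. (x \<bullet> b) *\<^sub>R b)"
    by (simp only: expand)
  also have "\<dots> = (\<Sum>b\<in>B. (\<mu> b * (x \<bullet> b)) *\<^sub>R b)"
    using linear by (simp add: linear_sum linear_scale eigen mult.commute)
  finally show ?thesis .
qed

lemma quadratic_form: "T x \<bullet> x = (\<Sum>b\<in>B. \<mu> b * (x \<bullet> b)\<^sup>2)"
  by (subst expand_image)
    (simp add: inner_sum_left power2_eq_square mult.assoc inner_commute[of x])

lemma parseval: "x \<bullet> x = (\<Sum>b\<in>B. (x \<bullet> b)\<^sup>2)"
proof -
  have "x \<bullet> x = (\<Sum>b\<in>B. (x \<bullet> b) *\<^sub>R b) \<bullet> x"
    by (simp only: expand)
  also have "\<dots> = (\<Sum>b\<in>B. (x \<bullet> b)\<^sup>2)"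
    by (simp add: inner_sum_left power2_eq_square inner_commute[of x])
  finally show ?thesis .
qed

lemma inner_image: "b \<in> B \<Longrightarrow> T x \<bullet> b = \<mu> b * (x \<bullet> b)"
  by (subst expand_image)
    (simp add: inner_sum_left inner_basis finite_basis if_distrib cong: if_cong)

text \<open>If \<open>T x = m x\<close>, comparing coordinates gives
  \<open>m * (x \<bullet> b) = \<mu> b * (x \<bullet> b)\<close>, so only the coordinates with
  \<open>\<mu> b = m\<close> survive in the expansion of \<open>x\<close>.\<close>

lemma eigenspace_eq: "eigenspace T m = span {b \<in> B. \<mu> b = m}"
proof
  show "eigenspace T m \<subseteq> span {b \<in> B. \<mu> b = m}"
  proof
    fix x assume "x \<in> eigenspace T m"
    then have Tx: "T x = m *\<^sub>R x"
      by (simp add: eigenspace_def)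
    have "x \<bullet> b = 0" if "b \<in> B" "\<mu> b \<noteq> m" for b
      using inner_image[OF that(1), of x] that(2) by (simp add: Tx)
    then have "(\<Sum>b\<in>B. (x \<bullet> b) *\<^sub>R b) = (\<Sum>b\<in>{b \<in> B. \<mu> b = m}. (x \<bullet> b) *\<^sub>R b)"
      using finite_basis by (intro sum.mono_neutral_right) auto
    also have "\<dots> \<in> span {b \<in> B. \<mu> b = m}"
      by (intro span_sum span_scale span_base)
    finally show "x \<in> span {b \<in> B. \<mu> b = m}"
      by (simp only: expand)
  qed
  have "subspace (eigenspace T m)"
    using linear unfolding subspace_def eigenspace_def
    by (auto simp: linear_0 linear_add linear_scale algebra_simps)
  then show "span {b \<in> B. \<mu> b = m} \<subseteq> eigenspace T m"
    by (intro span_minimal) (auto simp: eigenspace_def eigen)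
qed

lemma dim_eigenspace: "dim (eigenspace T m) = card {b \<in> B. \<mu> b = m}"
  unfolding eigenspace_eq
  by (intro dim_span_eq_card_independent independent_mono[OF independent_basis]) blast

lemma eigenvalues_eq: "eigenvalues T = \<mu> ` B"
proof (intro set_eqI iffI)
  fix m assume "m \<in> eigenvalues T"
  then obtain f where "f \<noteq> 0" "f \<in> span {b \<in> B. \<mu> b = m}"
    unfolding eigenspace_eq[symmetric] by (auto simp: eigenvalues_def eigenspace_def)
  then have "{b \<in> B. \<mu> b = m} \<noteq> {}"
    by (metis span_empty singletonD)
  then show "m \<in> \<mu> ` B"
    by blast
next
  fix m assume "m \<in> \<mu> ` B"
  then obtain b where "b \<in> B" "m = \<mu> b"
    by blast
  moreover from this have "b \<noteq> 0"
    using norm_1 by force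
  ultimately show "m \<in> eigenvalues T"
    unfolding eigenvalues_def using eigen by blast
qed

text \<open>Both multisets count \<open>m\<close> by the size of its fibre under \<mu>; outside the
  spectrum that fibre is empty.\<close>

lemma eigenvalue_list_eq: "eigenvalue_list T = sorted_list_of_multiset (image_mset \<mu> (mset_set B))"
proof -
  have "(\<Sum>m\<in>eigenvalues T. replicate_mset (dim (eigenspace T m)) m) = image_mset \<mu> (mset_set B)"
  proof (rule multiset_eqI)
    fix m
    have "count (image_mset \<mu> (mset_set B)) m = card {b \<in> B. \<mu> b = m}"
      using finite_basis by (simp add: count_image_mset' eq_commute)
    moreover have "{b \<in> B. \<mu> b = m} = {}" if "m \<notin> \<mu> ` B"
      using that by blast
    ultimately show "count (\<Sum>m\<in>eigenvalues T. replicate_mset (dim (eigenspace T m)) m) m =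
        count (image_mset \<mu> (mset_set B)) m"
      using finite_basis
      by (cases "m \<in> \<mu> ` B") (auto simp: count_sum eigenvalues_eq dim_eigenspace cong: if_cong)
  qed
  then show ?thesis
    by (simp add: eigenvalue_list_def)
qed

text \<open>Sorting the basis vectors by eigenvalue lets one index address both a list entry and its
  eigenvector, as is needed when weights are attached to the vectors.\<close>

lemma eigenvalue_list_enumeration:
  obtains bs where "distinct bs" "set bs = B" "eigenvalue_list T = map \<mu> bs" "sorted (map \<mu> bs)"
proof -
  obtain cs where cs: "set cs = B" "distinct cs"
    using finite_distinct_list[OF finite_basis] by blast
  define bs where "bs = sort_key \<mu> cs"
  have bs: "distinct bs" "set bs = B" "sorted (map \<mu> bs)"
    using cs by (simp_all add: bs_def)
  have "image_mset \<mu> (mset_set B) = mset (map \<mu> bs)"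
    using bs by (simp add: mset_set_set[symmetric])
  then have "eigenvalue_list T = map \<mu> bs"
    using bs(3) by (simp only: eigenvalue_list_eq sorted_list_of_multiset_mset sorted_sort_id)
  with bs that show thesis
    by blast
qed

end

lemma selfadjoint_orthonormal_eigenbasis:
  fixes T :: "'a::euclidean_space \<Rightarrow> 'a"
  assumes "linear T" and "\<And>x y. T x \<bullet> y = x \<bullet> T y"
  obtains B \<mu> where "orthonormal_eigenbasis T B \<mu>"
proof -
  obtain B where B: "pairwise orthogonal B" "\<forall>b\<in>B. norm b = 1" "span B = UNIV"
    "\<forall>b\<in>B. \<exists>m. T b = m *\<^sub>R b"
    using selfadjoint_orthonormal_eigenbasis_subspace[OF assms, of UNIV] by auto
  from B(4) obtain \<mu> where "\<forall>b\<in>B. T b = \<mu> b *\<^sub>R b"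
    by metis
  with B assms(1) have "orthonormal_eigenbasis T B \<mu>"
    by (simp add: orthonormal_eigenbasis_def)
  then show thesis
    by (rule that)
qed

section \<open>Ky Fan's inequality\<close>

text \<open>With \<open>p\<close> the orthogonal projection of \<open>x\<close> onto the span of the
  family, \<open>p \<bullet> p = p \<bullet> x\<close>, so the squared length of
  \<open>x - p\<close> is \<open>x \<bullet> x - p \<bullet> x\<close>.\<close>

lemma bessel_inequality:
  fixes g :: "'i \<Rightarrow> 'a::real_inner"
  assumes "finite I" and orth: "\<And>i j. i \<in> I \<Longrightarrow> j \<in> I \<Longrightarrow> g i \<bullet> g j = (if i = j then 1 else 0)"
  shows "(\<Sum>i\<in>I. (g i \<bullet> x)\<^sup>2) \<le> x \<bullet> x"
proof -
  define p where "p = (\<Sum>i\<in>I. (g i \<bullet> x) *\<^sub>R g i)"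
  have px: "p \<bullet> x = (\<Sum>i\<in>I. (g i \<bullet> x)\<^sup>2)"
    by (simp add: p_def inner_sum_left power2_eq_square)
  have "p \<bullet> g i = g i \<bullet> x" if "i \<in> I" for i
  proof -
    have "p \<bullet> g i = (\<Sum>j\<in>I. if j = i then g i \<bullet> x else 0)"
      unfolding p_def inner_sum_left using orth that by (intro sum.cong) auto
    then show ?thesis
      using assms(1) that by simp
  qed
  then have "p \<bullet> p = p \<bullet> x"
    unfolding px by (subst (2) p_def) (simp add: inner_sum_right power2_eq_square)
  moreover have "0 \<le> (x - p) \<bullet> (x - p)"
    by simp
  ultimately show ?thesis
    by (simp add: inner_diff_left inner_diff_right inner_commute[of x p] px)
qed

text \<open>
  Every term of \<open>\<Sum>i<N. (l i - l (n - 1)) * (w i - [i < n])\<close> is nonnegative, and subtracting the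
  constant \<open>l (n - 1)\<close> does not change the sum because the second factors add up to \<open>0\<close>.
\<close>
lemma sum_smallest_le_weighted_sum:
  fixes l w :: "nat \<Rightarrow> real"
  assumes mono: "\<And>i j. i \<le> j \<Longrightarrow> j < N \<Longrightarrow> l i \<le> l j"
    and w: "\<And>i. i < N \<Longrightarrow> 0 \<le> w i \<and> w i \<le> 1"
    and total: "(\<Sum>i<N. w i) = real n"
  shows "(\<Sum>i<n. l i) \<le> (\<Sum>i<N. l i * w i)"
proof -
  \<comment> \<open>Weights of at most 1 can total \<open>n\<close> only if there are at least
    \<open>n\<close> of them.\<close>
  have "(\<Sum>i<N. w i) \<le> (\<Sum>i<N. 1)"
    using w by (intro sum_mono) auto
  then have nN: "n \<le> N"
    by (simp add: total)
  define e :: "nat \<Rightarrow> real" where "e i = (if i < n then 1 else 0)" for i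
  have restr: "(\<Sum>i<N. f i * e i) = (\<Sum>i<n. f i)" for f :: "nat \<Rightarrow> real"
  proof -
    have "(\<Sum>i<N. f i * e i) = (\<Sum>i<n. f i * e i)"
      using nN by (intro sum.mono_neutral_right) (auto simp: e_def)
    then show ?thesis
      by (simp add: e_def)
  qed
  \<comment> \<open>For \<open>n = 0\<close> truncated subtraction makes the threshold
    \<open>l 0\<close>, and only the second case below occurs.\<close>
  have "0 \<le> (\<Sum>i<N. (l i - l (n - 1)) * (w i - e i))"
  proof (rule sum_nonneg)
    fix i assume i: "i \<in> {..<N}"
    show "0 \<le> (l i - l (n - 1)) * (w i - e i)"
    proof (cases "i < n")
      case True
      then show ?thesis
        using mono[of i "n - 1"] w[of i] i nN by (intro mult_nonpos_nonpos) (auto simp: e_def)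
    next
      case False
      then show ?thesis
        using mono[of "n - 1" i] w[of i] i by (intro mult_nonneg_nonneg) (auto simp: e_def)
    qed
  qed
  also have "\<dots> = (\<Sum>i<N. l i * w i) - (\<Sum>i<N. l i * e i)
      - l (n - 1) * ((\<Sum>i<N. w i) - (\<Sum>i<N. 1 * e i))"
    by (simp add: algebra_simps sum_subtractf sum.distrib flip: sum_distrib_left sum_distrib_right)
  also have "\<dots> = (\<Sum>i<N. l i * w i) - (\<Sum>i<n. l i)"
    unfolding restr total by simp
  finally show ?thesis
    by simp
qed

text \<open>In an eigenbasis the trace on the right becomes the sum of \<open>\<mu> b * w b\<close>,
  where \<open>w b\<close> is the squared length of the projection of \<open>b\<close> onto the span
  of the \<open>g i\<close>. Bessel puts these weights in [0,1] and Parseval makes them total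
  \<open>card I\<close>, so putting weight 1 on the smallest eigenvalues can only lower the
  sum.\<close>

theorem ky_fan_inequality:
  fixes T :: "'a::euclidean_space \<Rightarrow> 'a" and g :: "'i \<Rightarrow> 'a"
  assumes "linear T" and "\<And>x y. T x \<bullet> y = x \<bullet> T y"
    and fin: "finite I" and orth: "\<And>i j. i \<in> I \<Longrightarrow> j \<in> I \<Longrightarrow> g i \<bullet> g j = (if i = j then 1 else 0)"
  shows "(\<Sum>k<card I. eigenvalue_list T ! k) \<le> (\<Sum>i\<in>I. T (g i) \<bullet> g i)"
proof -
  obtain B \<mu> where "orthonormal_eigenbasis T B \<mu>"
    using selfadjoint_orthonormal_eigenbasis assms(1,2) by blast
  then interpret orthonormal_eigenbasis T B \<mu> .
  obtain bs where bs: "distinct bs" "set bs = B" "eigenvalue_list T = map \<mu> bs" "sorted (map \<mu> bs)"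
    by (rule eigenvalue_list_enumeration)
  define w where "w b = (\<Sum>i\<in>I. (g i \<bullet> b)\<^sup>2)" for b
  have reindex: "(\<Sum>k<length bs. f (bs ! k)) = (\<Sum>b\<in>B. f b)" for f :: "'a \<Rightarrow> real"
    using sum.reindex_bij_betw[OF bij_betw_nth[OF bs(1) refl refl]] bs(2) by simp
  have nonneg: "0 \<le> w b" for b
    by (simp add: w_def sum_nonneg)
  have le_1: "w b \<le> 1" if "b \<in> B" for b
    using bessel_inequality[OF fin orth, of b] inner_basis[OF that that] by (simp add: w_def)
  have "(\<Sum>b\<in>B. w b) = (\<Sum>i\<in>I. g i \<bullet> g i)"
    unfolding w_def parseval by (rule sum.swap)
  also have "\<dots> = real (card I)"
    by (simp add: orth)
  finally have total: "(\<Sum>b\<in>B. w b) = real (card I)" .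
  have "(\<Sum>k<card I. eigenvalue_list T ! k) \<le>
      (\<Sum>k<length bs. eigenvalue_list T ! k * w (bs ! k))"
  proof (rule sum_smallest_le_weighted_sum)
    show "eigenvalue_list T ! i \<le> eigenvalue_list T ! j" if "i \<le> j" "j < length bs" for i j
      unfolding bs(3) using sorted_nth_mono[OF bs(4) that(1)] that(2) by simp
    show "0 \<le> w (bs ! i) \<and> w (bs ! i) \<le> 1" if "i < length bs" for i
      using nonneg le_1 nth_mem[OF that] bs(2) by blast
    show "(\<Sum>k<length bs. w (bs ! k)) = real (card I)"
      by (simp add: reindex total)
  qed
  also have "\<dots> = (\<Sum>b\<in>B. \<mu> b * w b)"
    by (simp add: bs(3) reindex[of "\<lambda>b. \<mu> b * w b", symmetric])
  also have "\<dots> = (\<Sum>i\<in>I. T (g i) \<bullet> g i)"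
    unfolding w_def quadratic_form sum_distrib_left by (rule sum.swap)
  finally show ?thesis .
qed

section \<open>Conjugating the Laplacian to a symmetric operator\<close>

text \<open>\<open>P\<close> maps each eigenspace of \<open>T\<close> isomorphically onto that of
  \<open>T'\<close> for the same eigenvalue. It may distort inner products, as multiplication by the
  square root of \<pi> does.\<close>

lemma eigenvalue_list_conjugate:
  fixes T :: "'a::euclidean_space \<Rightarrow> 'a" and T' :: "'b::euclidean_space \<Rightarrow> 'b"
  assumes lin: "linear P" and bij: "bij P" and conj: "\<And>x. T' (P x) = P (T x)"
  shows "eigenvalue_list T' = eigenvalue_list T"
proof -
  have inj: "P x = P y \<longleftrightarrow> x = y" for x y
    using bij by (simp add: bij_is_inj inj_eq)
  have eig: "T' (P x) = m *\<^sub>R P x \<longleftrightarrow> T x = m *\<^sub>R x" for x m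
    by (simp add: conj inj flip: linear_scale[OF lin])
  have zero: "P x = 0 \<longleftrightarrow> x = 0" for x
    using inj[of x 0] by (simp add: linear_0[OF lin])
  have range: "\<exists>x. y = P x" for y
    using bij by (metis bij_pointE)
  have "eigenspace T' m = P ` eigenspace T m" for m
    using eig range by (fastforce simp: eigenspace_def)
  moreover have "dim (P ` eigenspace T m) = dim (eigenspace T m)" for m
    using lin bij_is_inj[OF bij] by (intro dim_image_eq) (auto intro: inj_on_subset)
  moreover have "eigenvalues T' = eigenvalues T"
    unfolding eigenvalues_def by (metis eig range zero)
  ultimately show ?thesis
    by (simp add: eigenvalue_list_def)
qed

context
  fixes K :: "'v::finite \<Rightarrow> 'v \<Rightarrow> real" and \<pi> :: "'v \<Rightarrow> real"
  assumes \<pi>_pos: "\<And>u. 0 < \<pi> u"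
begin

definition sqrt_weight :: "real ^ 'v \<Rightarrow> real ^ 'v" where
  "sqrt_weight f = (\<chi> u. sqrt (\<pi> u) * f $ u)"

text \<open>The conjugate of the Laplacian by \<open>sqrt_weight\<close>, written entrywise so that
  no inverse map has to be named.\<close>

definition sym_laplacian :: "real ^ 'v \<Rightarrow> real ^ 'v" where
  "sym_laplacian f = f - (\<chi> u. \<Sum>v\<in>UNIV. sqrt (\<pi> u) * sym_kernel K \<pi> u v / sqrt (\<pi> v) * f $ v)"

lemma linear_sqrt_weight: "linear sqrt_weight"
  by (intro linearI) (simp_all add: sqrt_weight_def vec_eq_iff algebra_simps)

lemma bij_sqrt_weight: "bij sqrt_weight"
  using \<pi>_pos[THEN less_imp_neq]
  by (intro bijI injI surjI[where f = "\<lambda>f. \<chi> u. f $ u / sqrt (\<pi> u)"])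
    (auto simp: sqrt_weight_def vec_eq_iff)

lemma sym_laplacian_sqrt_weight: "sym_laplacian (sqrt_weight f) = sqrt_weight (laplacian K \<pi> f)"
  using \<pi>_pos[THEN less_imp_neq]
  by (simp add: sym_laplacian_def sqrt_weight_def laplacian_def vec_eq_iff right_diff_distrib
      sum_distrib_left mult.assoc)

lemma linear_sym_laplacian: "linear sym_laplacian"
  by (intro linearI)
    (simp_all add: sym_laplacian_def vec_eq_iff algebra_simps sum.distrib sum_distrib_left
      add_divide_distrib)

text \<open>The right side is symmetric in \<open>u\<close> and \<open>v\<close>: this is detailed
  balance for the symmetrised kernel.\<close>

lemma weight_sym_kernel: "\<pi> u * sym_kernel K \<pi> u v = (flow K \<pi> u v + flow K \<pi> v u) / 2"
  using \<pi>_pos[of u] by (simp add: sym_kernel_def flow_def field_simps)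

text \<open>Clearing denominators reduces this to detailed balance.\<close>

lemma sym_laplacian_matrix_symmetric:
  "sqrt (\<pi> u) * sym_kernel K \<pi> u v / sqrt (\<pi> v) = sqrt (\<pi> v) * sym_kernel K \<pi> v u / sqrt (\<pi> u)"
proof -
  have eq: "\<pi> u * sym_kernel K \<pi> u v = \<pi> v * sym_kernel K \<pi> v u"
    by (simp add: weight_sym_kernel)
  have sq: "sqrt (\<pi> w) * k * sqrt (\<pi> w) = \<pi> w * k" for w k
  proof -
    have "sqrt (\<pi> w) * k * sqrt (\<pi> w) = (sqrt (\<pi> w) * sqrt (\<pi> w)) * k"
      by (simp only: mult_ac)
    then show ?thesis
      using \<pi>_pos[of w] by (simp add: less_imp_le)
  qed
  have "sqrt (\<pi> u) \<noteq> 0" "sqrt (\<pi> v) \<noteq> 0"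
    using \<pi>_pos[of u] \<pi>_pos[of v] by simp_all
  then show ?thesis
    by (subst frac_eq_eq) (assumption+, simp only: sq eq)
qed

lemma sym_laplacian_selfadjoint: "sym_laplacian f \<bullet> g = f \<bullet> sym_laplacian g"
proof -
  define M where "M u v = sqrt (\<pi> u) * sym_kernel K \<pi> u v / sqrt (\<pi> v)" for u v
  have sym: "M u v = M v u" for u v
    unfolding M_def by (rule sym_laplacian_matrix_symmetric)
  have sym_laplacian_eq: "sym_laplacian f = f - (\<chi> u. \<Sum>v\<in>UNIV. M u v * f $ v)" for f
    by (simp add: sym_laplacian_def M_def)
  have "(\<Sum>u\<in>UNIV. \<Sum>v\<in>UNIV. M u v * f $ v * g $ u) =
      (\<Sum>v\<in>UNIV. \<Sum>u\<in>UNIV. M u v * f $ v * g $ u)"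
    by (rule sum.swap)
  also have "\<dots> = (\<Sum>u\<in>UNIV. \<Sum>v\<in>UNIV. f $ u * (M u v * g $ v))"
    by (intro sum.cong refl) (simp add: sym mult_ac)
  finally show ?thesis
    by (simp add: sym_laplacian_eq inner_vec_def left_diff_distrib
        right_diff_distrib sum_subtractf sum_distrib_left sum_distrib_right)
qed

section \<open>Indicators as test functions and the isoperimetric bound\<close>

lemma sqrt_weight_inner: "sqrt_weight f \<bullet> sqrt_weight g = (\<Sum>u\<in>UNIV. \<pi> u * f $ u * g $ u)"
proof -
  have "(sqrt (\<pi> u) * a) * (sqrt (\<pi> u) * b) = \<pi> u * a * b" for u a b
  proof -
    have "(sqrt (\<pi> u) * a) * (sqrt (\<pi> u) * b) = (sqrt (\<pi> u) * sqrt (\<pi> u)) * a * b"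
      by (simp only: mult_ac)
    then show ?thesis
      using \<pi>_pos[of u] by (simp add: less_imp_le)
  qed
  then show ?thesis
    by (simp only: sqrt_weight_def inner_vec_def vec_lambda_beta inner_real_def)
qed

text \<open>The form equals \<pi>(Q) minus the symmetrised flow inside \<open>Q\<close>. Summed over
  all pairs from \<open>Q\<close>, symmetrising changes nothing, and what is left of \<pi>(Q) is the
  flow leaving \<open>Q\<close>.\<close>

lemma laplacian_indicator_form:
  fixes Q :: "'v set"
  assumes rows: "\<And>u. (\<Sum>v\<in>UNIV. K u v) = 1"
  defines "f \<equiv> \<chi> u. indicator Q u"
  shows "sqrt_weight (laplacian K \<pi> f) \<bullet> sqrt_weight f = out_boundary K \<pi> Q"
proof -
  have "sqrt_weight (laplacian K \<pi> f) \<bullet> sqrt_weight f =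
      (\<Sum>u\<in>Q. \<pi> u * (1 - (\<Sum>v\<in>Q. sym_kernel K \<pi> u v)))"
    unfolding sqrt_weight_inner
    by (simp add: f_def laplacian_def sum.If_cases indicator_def if_distrib cong: if_cong)
  also have "\<dots> = (\<Sum>u\<in>Q. \<pi> u) - (\<Sum>u\<in>Q. \<Sum>v\<in>Q. (flow K \<pi> u v + flow K \<pi> v u) / 2)"
    by (simp add: right_diff_distrib sum_subtractf sum_distrib_left weight_sym_kernel)
  also have "(\<Sum>u\<in>Q. \<Sum>v\<in>Q. (flow K \<pi> u v + flow K \<pi> v u) / 2) = (\<Sum>u\<in>Q. \<Sum>v\<in>Q. flow K \<pi> u v)"
    using sum.swap[of "\<lambda>u v. flow K \<pi> u v" Q Q]
    by (simp add: sum.distrib add_divide_distrib flip: sum_divide_distrib)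
  \<comment> \<open>Unit row sums make the total flow out of \<open>u\<close> equal to
    \<open>\<pi> u\<close>; it is split by whether the target lies in \<open>Q\<close>.\<close>
  also have "(\<Sum>u\<in>Q. \<pi> u) = (\<Sum>u\<in>Q. (\<Sum>v\<in>Q. flow K \<pi> u v) + (\<Sum>v\<in>-Q. flow K \<pi> u v))"
  proof (rule sum.cong)
    fix u
    have "(\<Sum>v\<in>Q. flow K \<pi> u v) + (\<Sum>v\<in>-Q. flow K \<pi> u v) = (\<Sum>v\<in>UNIV. flow K \<pi> u v)"
      by (subst sum.union_disjoint[symmetric]) auto
    then show "\<pi> u = (\<Sum>v\<in>Q. flow K \<pi> u v) + (\<Sum>v\<in>-Q. flow K \<pi> u v)"
      by (simp add: flow_def rows flip: sum_distrib_right)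
  qed simp
  finally show ?thesis
    by (simp add: out_boundary_def sum.distrib)
qed

lemma sum_lap_eigenvalues_le:
  assumes rows: "\<And>u. (\<Sum>v\<in>UNIV. K u v) = 1"
    and ne: "\<And>i. i \<in> {1..n} \<Longrightarrow> Q i \<noteq> {}" and disj: "disjoint_family_on Q {1..n}"
  shows "(\<Sum>i=1..n. lap_eigenvalue K \<pi> i) \<le> (\<Sum>i=1..n. out_boundary K \<pi> (Q i) / sum \<pi> (Q i))"
proof -
  define f :: "nat \<Rightarrow> real ^ 'v" where "f i = (\<chi> u. indicator (Q i) u)" for i
  \<comment> \<open>The reciprocal of the weighted norm of the indicator of
    \<open>Q i\<close>.\<close>
  define c where "c i = 1 / sqrt (sum \<pi> (Q i))" for i
  define g where "g i = c i *\<^sub>R sqrt_weight (f i)" for i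
  have pos: "0 < sum \<pi> (Q i)" if "i \<in> {1..n}" for i
    using ne[OF that] \<pi>_pos by (intro sum_pos) auto
  then have c2: "c i * c i = 1 / sum \<pi> (Q i)" if "i \<in> {1..n}" for i
    using that by (simp add: c_def less_imp_le)
  have ff: "sqrt_weight (f i) \<bullet> sqrt_weight (f j) = sum \<pi> (Q i \<inter> Q j)" for i j
    unfolding sqrt_weight_inner f_def
    by (simp add: indicator_def sum.If_cases if_distrib Int_commute cong: if_cong)
  have orth: "g i \<bullet> g j = (if i = j then 1 else 0)" if "i \<in> {1..n}" "j \<in> {1..n}" for i j
  proof (cases "i = j")
    case True
    then show ?thesis
      using c2[OF that(1)] pos[OF that(1)] by (simp add: g_def ff flip: mult.assoc)
  next
    case False
    then have "Q i \<inter> Q j = {}"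
      using disj that by (auto simp: disjoint_family_on_def)
    with False show ?thesis
      by (simp add: g_def ff)
  qed
  have form: "sym_laplacian (g i) \<bullet> g i = out_boundary K \<pi> (Q i) / sum \<pi> (Q i)"
    if "i \<in> {1..n}" for i
  proof -
    have "sym_laplacian (g i) \<bullet> g i = c i * c i * out_boundary K \<pi> (Q i)"
      by (simp add: g_def linear_scale[OF linear_sym_laplacian] sym_laplacian_sqrt_weight f_def
          laplacian_indicator_form[OF rows])
    then show ?thesis
      by (simp add: c2[OF that])
  qed
  \<comment> \<open>Eigenvalues are numbered from 1, list positions from 0.\<close>
  have "(\<Sum>i=1..n. lap_eigenvalue K \<pi> i) = (\<Sum>k<n. eigenvalue_list (laplacian K \<pi>) ! k)"
    unfolding lap_eigenvalue_def by (rule sum.reindex_bij_witness[of _ Suc "\<lambda>i. i - 1"]) auto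
  also have "eigenvalue_list (laplacian K \<pi>) = eigenvalue_list sym_laplacian"
    by (rule eigenvalue_list_conjugate[OF linear_sqrt_weight bij_sqrt_weight, symmetric])
      (rule sym_laplacian_sqrt_weight)
  also have "(\<Sum>k<n. eigenvalue_list sym_laplacian ! k) \<le> (\<Sum>i=1..n. sym_laplacian (g i) \<bullet> g i)"
    using ky_fan_inequality[OF linear_sym_laplacian sym_laplacian_selfadjoint
        finite_atLeastAtMost, of 1 n g] orth by simp
  also have "\<dots> = (\<Sum>i=1..n. out_boundary K \<pi> (Q i) / sum \<pi> (Q i))"
    by (intro sum.cong refl form)
  finally show ?thesis .
qed

end

theorem theorem3:
  fixes E :: "('v::finite \<times> 'v) set"
    and K :: "'v \<Rightarrow> 'v \<Rightarrow> real"
    and \<pi> :: "'v \<Rightarrow> real"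
    and n :: nat
  assumes kernel: "graph_kernel E K"
    and stationary: "stationary_distribution K \<pi>"
    and nowhere_zero: "\<forall>u. \<pi> u \<noteq> 0"
    and n_ge: "1 \<le> n"
    and n_le: "n \<le> CARD('v)"
  shows "mean_lap_eigenvalue K \<pi> n \<le> iso_constant K \<pi> n"
proof -
  have pos: "0 < \<pi> u" for u
    using stationary nowhere_zero unfolding stationary_distribution_def by (metis order_le_less)
  have rows: "(\<Sum>v\<in>UNIV. K u v) = 1" for u
    using kernel by (simp add: graph_kernel_def)
  have "mean_lap_eigenvalue K \<pi> n \<le> mean_expansion K \<pi> n Q"
    if "Q \<in> disjoint_nonempty_families n" for Q :: "nat \<Rightarrow> 'v set"
    unfolding mean_lap_eigenvalue_def mean_expansion_def
    using that sum_lap_eigenvalues_le[OF pos rows, of n Q]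
    by (intro mult_left_mono) (auto simp: disjoint_nonempty_families_def)
  \<comment> \<open>A bound valid for every family passes to \<open>Min\<close> because the set of
    values is finite and nonempty; nonemptiness comes from \<open>n_le\<close>.\<close>
  then show ?thesis
    unfolding iso_constant_def
    using finite_mean_expansions disjoint_nonempty_families_nonempty[OF n_le]
    by (subst Min_ge_iff) auto
qed

end
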